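(* Let $S$ be a monoid equipped with a monoid homomorphism $\theta \colon S \rightarrow (\mathbb{N},+)$ that satisfies the unique factorization property. Then $S$ is a free monoid.
   Context: Here $\mathbb{N}=\{0,1,2,\ldots\}$. A monoid homomorphism $\theta \colon S \rightarrow \mathbb{N}$ satisfies the unique factorization property (UFP) if, whenever $a \in S$ and $m,n \in \mathbb{N}$ are such that $\theta(a) = m+n$, there are unique elements $b,c \in S$ such that $a = bc$, $\theta(b) = m$ and $\theta(c) = n$. A free monoid is a monoid isomorphic to $A^{\ast}$, the monoid of all finite strings over some set $A$ (possibly empty, possibly infinite) under concatenation. *)

theory Defs
  imports "HOL-Algebra.Group"
begin

definition nat_add_monoid :: "nat monoid" where
  "nat_add_monoid = \<lparr>carrier = UNIV, monoid.mult = (+), one = 0\<rparr>"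

text \<open>The library's \<^const>\<open>hom\<close> does not require preservation of the unit, so it is
  stated separately.\<close>

definition monoid_hom :: "('a, 'm) monoid_scheme \<Rightarrow> ('b, 'n) monoid_scheme \<Rightarrow> ('a \<Rightarrow> 'b) set" where
  "monoid_hom S T = {h \<in> hom S T. h \<one>\<^bsub>S\<^esub> = \<one>\<^bsub>T\<^esub>}"

definition UFP :: "('a, 'm) monoid_scheme \<Rightarrow> ('a \<Rightarrow> nat) \<Rightarrow> bool" where
  "UFP S \<theta> \<longleftrightarrow>
     (\<forall>a \<in> carrier S. \<forall>m n. \<theta> a = m + n \<longrightarrow>
        (\<exists>!(b, c). b \<in> carrier S \<and> c \<in> carrier S \<and> a = b \<otimes>\<^bsub>S\<^esub> c \<and> \<theta> b = m \<and> \<theta> c = n))"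

definition string_monoid :: "'a set \<Rightarrow> 'a list monoid" where
  "string_monoid A = \<lparr>carrier = lists A, monoid.mult = (@), one = []\<rparr>"

text \<open>One cannot quantify over the type of letters, so the alphabet is taken inside the
  element type of the monoid. This is no restriction: see \<open>free_monoidI\<close> below.
  A multiplicative bijection between monoids automatically preserves the unit, so the
  library's \<open>\<cong>\<close> is monoid isomorphism here.\<close>

definition free_monoid :: "('a, 'm) monoid_scheme \<Rightarrow> bool" where
  "free_monoid S \<longleftrightarrow> monoid S \<and> (\<exists>A :: 'a set. S \<cong> string_monoid A)"

lemma monoid_nat_add_monoid: "monoid nat_add_monoid"
  by unfold_locales (auto simp: nat_add_monoid_def)

lemma monoid_string_monoid: "monoid (string_monoid A)"
  by unfold_locales (auto simp: string_monoid_def)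

lemma free_monoidI:
  fixes S :: "('a, 'm) monoid_scheme" and A :: "'b set"
  assumes "monoid S" and "S \<cong> string_monoid A"
  shows "free_monoid S"
proof -
  from assms(2) obtain h where h: "h \<in> iso S (string_monoid A)"
    by (auto simp: is_iso_def)
  then have bij: "bij_betw h (carrier S) (lists A)"
    by (auto simp: iso_def string_monoid_def)
  define e where "e a = inv_into (carrier S) h [a]" for a
  have inj_e: "inj_on e A"
  proof (rule inj_onI)
    fix x y assume "x \<in> A" "y \<in> A" "e x = e y"
    moreover have "h (e z) = [z]" if "z \<in> A" for z
      unfolding e_def using bij that by (intro bij_betw_inv_into_right[OF bij]) auto
    ultimately show "x = y" by (metis list.inject)
  qed
  have "inj_on (map e) (lists A)"
  proof (rule inj_onI)
    fix xs ys assume "xs \<in> lists A" "ys \<in> lists A" "map e xs = map e ys"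
    moreover have "inj_on e (set xs \<union> set ys)"
      using calculation by (intro inj_on_subset[OF inj_e]) auto
    ultimately show "xs = ys" using inj_on_map_eq_map by blast
  qed
  then have "bij_betw (map e) (lists A) (lists (e ` A))"
    by (simp add: bij_betw_def lists_image)
  then have "map e \<in> iso (string_monoid A) (string_monoid (e ` A))"
    by (auto simp: iso_def hom_def string_monoid_def)
  then have "S \<cong> string_monoid (e ` A)"
    using iso_set_trans[OF h] by (auto simp: is_iso_def)
  then show ?thesis using assms(1) by (auto simp: free_monoid_def)
qed

end

theory Submission
  imports Defs
begin

text \<open>Unique factorization of \<open>a = a \<one> = \<one> a\<close> shows that the identity is the only
  element of degree 0. Splitting off a factor of degree 1 from the left, again and again, writes
  every element uniquely as a product of elements of degree 1, so these form a free basis.\<close>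

text \<open>The existence half of the factorization property, in elimination form; surjectivity of
  \<open>eval_word\<close> uses it to split off a first letter.\<close>

lemma UFP_exists:
  assumes "UFP S \<theta>" "a \<in> carrier S" "\<theta> a = m + n"
  obtains b c where "b \<in> carrier S" "c \<in> carrier S" "a = b \<otimes>\<^bsub>S\<^esub> c" "\<theta> b = m" "\<theta> c = n"
proof -
  from assms have "\<exists>!(b, c). b \<in> carrier S \<and> c \<in> carrier S \<and> a = b \<otimes>\<^bsub>S\<^esub> c \<and> \<theta> b = m \<and> \<theta> c = n"
    unfolding UFP_def by blast
  then show thesis using that by auto
qed

text \<open>Needed because the isomorphism is built from words to \<open>S\<close>, whereas
  \<open>free_monoid\<close> asks for one starting at \<open>S\<close>. The inverse bijection is
  multiplicative because \<open>h\<close> sends both sides of the required identity to the same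
  element.\<close>

lemma (in monoid) is_iso_sym:
  assumes "G \<cong> H"
  shows "H \<cong> G"
proof -
  obtain h where h: "h \<in> hom G H" and bij: "bij_betw h (carrier G) (carrier H)"
    using assms by (auto simp: is_iso_def iso_def)
  let ?g = "inv_into (carrier G) h"
  have g: "bij_betw ?g (carrier H) (carrier G)"
    using bij by (rule bij_betw_inv_into)
  have "?g (x \<otimes>\<^bsub>H\<^esub> y) = ?g x \<otimes> ?g y" if "x \<in> carrier H" "y \<in> carrier H" for x y
  proof -
    have closed: "?g x \<in> carrier G" "?g y \<in> carrier G"
      using that g by (auto dest: bij_betwE)
    then have "h (?g x \<otimes> ?g y) = x \<otimes>\<^bsub>H\<^esub> y"
      using hom_mult[OF h closed] that bij by (simp add: bij_betw_inv_into_right)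
    then show ?thesis
      using closed bij by (metis bij_betw_inv_into_left m_closed)
  qed
  then have "?g \<in> iso H G"
    using g by (auto simp: iso_def hom_def dest: bij_betwE)
  then show ?thesis by (auto simp: is_iso_def)
qed

locale graded_UFP_monoid = monoid S for S :: "('a, 'm) monoid_scheme" (structure) +
  fixes \<theta> :: "'a \<Rightarrow> nat"
  assumes hom: "\<theta> \<in> monoid_hom S nat_add_monoid"
    and UFP: "UFP S \<theta>"
begin

lemma degree_mult: "x \<in> carrier S \<Longrightarrow> y \<in> carrier S \<Longrightarrow> \<theta> (x \<otimes> y) = \<theta> x + \<theta> y"
  using hom by (auto simp: monoid_hom_def hom_def nat_add_monoid_def)

lemma degree_one: "\<theta> \<one> = 0"
  using hom by (auto simp: monoid_hom_def nat_add_monoid_def)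

text \<open>The uniqueness half, as a cancellation rule. Comparing the left degrees suffices:
  additivity of the degree and cancellation in the naturals then force the right degrees to
  agree.\<close>

lemma factorization_unique:
  assumes "b \<in> carrier S" "c \<in> carrier S" "b' \<in> carrier S" "c' \<in> carrier S"
    and "b \<otimes> c = b' \<otimes> c'" "\<theta> b = \<theta> b'"
  shows "b = b' \<and> c = c'"
proof -
  have "\<theta> c = \<theta> c'"
    using assms degree_mult[of b c] degree_mult[of b' c'] by simp
  \<comment> \<open>\<open>UFP\<close> is applied to the product itself, in degrees
    \<open>\<theta> b\<close> and \<open>\<theta> c\<close>; both given pairs are witnesses, hence
    equal.\<close>
  moreover have "\<exists>!(u, v). u \<in> carrier S \<and> v \<in> carrier S \<and> b \<otimes> c = u \<otimes> v \<and> \<theta> u = \<theta> b \<and> \<theta> v = \<theta> c"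
    using UFP assms(1,2) by (simp add: UFP_def degree_mult)
  ultimately have "(b, c) = (b', c')"
    using assms by (elim ex1E) (metis (mono_tags, lifting) case_prod_conv)
  then show ?thesis by simp
qed

lemma degree_eq_0_iff:
  assumes "a \<in> carrier S"
  shows "\<theta> a = 0 \<longleftrightarrow> a = \<one>"
  using factorization_unique[of a \<one> \<one> a] assms by (auto simp: degree_one)

definition letters :: "'a set" where
  "letters = {a \<in> carrier S. \<theta> a = 1}"

text \<open>Folding from the right makes the head letter the left factor of the product, which
  matches factorizations of degrees 1 and \<open>n\<close>.\<close>

definition eval_word :: "'a list \<Rightarrow> 'a" where
  "eval_word xs = foldr (\<otimes>) xs \<one>"

lemma eval_word_simps [simp]:
  "eval_word [] = \<one>" "eval_word (x # xs) = x \<otimes> eval_word xs"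
  by (simp_all add: eval_word_def)

lemma eval_word_closed: "xs \<in> lists letters \<Longrightarrow> eval_word xs \<in> carrier S"
  by (induction xs) (auto simp: letters_def)

lemma eval_word_append:
  "xs \<in> lists letters \<Longrightarrow> ys \<in> lists letters \<Longrightarrow> eval_word (xs @ ys) = eval_word xs \<otimes> eval_word ys"
  by (induction xs) (auto simp: letters_def m_assoc eval_word_closed)

text \<open>The element thus determines the length of any word that represents it, so injectivity
  only has to be checked on words of equal length.\<close>

lemma degree_eval_word: "xs \<in> lists letters \<Longrightarrow> \<theta> (eval_word xs) = length xs"
  by (induction xs) (auto simp: letters_def degree_one degree_mult eval_word_closed)

lemma inj_on_eval_word: "inj_on eval_word (lists letters)"
proof -
  have "xs = ys" if "xs \<in> lists letters" "ys \<in> lists letters"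
    "length xs = length ys" "eval_word xs = eval_word ys" for xs ys
    using that(3,1,2,4)
  proof (induction rule: list_induct2)
    case (Cons x xs y ys)
    then have "x \<in> carrier S" "y \<in> carrier S" "\<theta> x = \<theta> y"
      and lists: "xs \<in> lists letters" "ys \<in> lists letters"
      by (simp_all add: letters_def)
    \<comment> \<open>Both heads are letters, so the two factorizations have left degree 1 and must
      coincide.\<close>
    then have "x = y \<and> eval_word xs = eval_word ys"
      using Cons.prems(3) by (intro factorization_unique) (simp_all add: eval_word_closed)
    then show ?case using Cons.IH lists by simp
  qed simp
  then show ?thesis
    by (intro inj_onI) (metis degree_eval_word)
qed

text \<open>Induction on the degree: the empty word covers degree 0, and for degree
  \<open>Suc n\<close> the factorization in degrees 1 and \<open>n\<close> supplies a head letter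
  and a smaller element.\<close>

lemma eval_word_surj: "a \<in> carrier S \<Longrightarrow> a \<in> eval_word ` lists letters"
proof (induction "\<theta> a" arbitrary: a)
  case 0
  then have "a = eval_word []" using degree_eq_0_iff by simp
  then show ?case by blast
next
  case (Suc n)
  obtain b c where bc: "b \<in> carrier S" "c \<in> carrier S" "a = b \<otimes> c" "\<theta> b = 1" "\<theta> c = n"
    using UFP_exists[OF UFP, of a 1 n] Suc.prems Suc.hyps(2) by auto
  then obtain xs where xs: "xs \<in> lists letters" "c = eval_word xs"
    using Suc.hyps(1) by blast
  then have "a = eval_word (b # xs)" "b # xs \<in> lists letters"
    using bc by (auto simp: letters_def)
  then show ?case by blast
qed

lemma eval_word_iso: "eval_word \<in> iso (string_monoid letters) S"
proof -
  have "eval_word ` lists letters = carrier S"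
    using eval_word_surj eval_word_closed by blast
  then show ?thesis
    using inj_on_eval_word eval_word_closed eval_word_append
    by (auto simp: iso_def hom_def bij_betw_def string_monoid_def)
qed

lemma free: "free_monoid S"
proof -
  have "S \<cong> string_monoid letters"
    using monoid.is_iso_sym[OF monoid_string_monoid] eval_word_iso by (auto simp: is_iso_def)
  then show ?thesis using free_monoidI monoid_axioms by blast
qed

end

theorem theorem2p4:
  fixes S :: "('a, 'm) monoid_scheme" and \<theta> :: "'a \<Rightarrow> nat"
  assumes "monoid S"
    and "\<theta> \<in> monoid_hom S nat_add_monoid"
    and "UFP S \<theta>"
  shows "free_monoid S"
proof -
  interpret monoid S by fact
  interpret graded_UFP_monoid S \<theta> by unfold_locales fact+
  show ?thesis by (rule free)
qed

end
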